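(* Let $\Gamma$ be a finite nonempty alphabet and let $n,k$ be positive integers. Then the number of cycles in the factor $F_k(r_n)$ produced by the pure cycling register rule $r_n$ is $$|F_k(r_n)|=\frac{(n:k)}{n}\sum_{(n:k)\mid d\mid n}\varphi(n/d)\,|\Gamma|^d,$$ where the sum is over all positive integers $d$ with $(n:k)\mid d$ and $d\mid n$.
   Context: $(n:k)$ denotes the greatest common divisor of $n$ and $k$; $\varphi$ is Euler's totient function. The pure cycling register rule is $r_n:\Gamma^n\to\Gamma^n$, $r_n(a_0a_1\cdots a_{n-1})=a_1\cdots a_{n-1}a_0$. $F_k(r_n)$ is the set of orbits (cycles) of the bijection $A_k(r_n):\Gamma^n\times\mathbb{Z}/k\mathbb{Z}\to\Gamma^n\times\mathbb{Z}/k\mathbb{Z}$, $(s,i)\mapsto(r_n(s),i+1)$. *)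

theory Defs
  imports
    Complex_Main
    "HOL-Combinatorics.Orbits"
    "HOL-Number_Theory.Totient"
begin

definition words :: "'a set \<Rightarrow> nat \<Rightarrow> 'a list set" where
  "words \<Gamma> n = {s. set s \<subseteq> \<Gamma> \<and> length s = n}"

(* rotate1 is the map a_0 a_1 ... a_(n-1) |-> a_1 ... a_(n-1) a_0, for every length n at once. *)
definition pure_cycling :: "'a list \<Rightarrow> 'a list" where
  "pure_cycling = rotate1"

(* Z/kZ is represented by the residues {0..<k}. *)
definition factor_carrier :: "'a set \<Rightarrow> nat \<Rightarrow> nat \<Rightarrow> ('a list \<times> nat) set" where
  "factor_carrier \<Gamma> n k = words \<Gamma> n \<times> {0..<k}"

definition factor_map :: "nat \<Rightarrow> ('a list \<Rightarrow> 'a list) \<Rightarrow> 'a list \<times> nat \<Rightarrow> 'a list \<times> nat" where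
  "factor_map k r = (\<lambda>(s, i). (r s, (i + 1) mod k))"

(* The library's orbit f x is the set of f-iterates of x of positive exponent; for a bijection of a
   finite set this is the full cycle through x. *)
definition factor_cycles :: "'a set \<Rightarrow> nat \<Rightarrow> nat \<Rightarrow> ('a list \<Rightarrow> 'a list) \<Rightarrow> ('a list \<times> nat) set set" where
  "factor_cycles \<Gamma> n k r = orbit (factor_map k r) ` factor_carrier \<Gamma> n k"

lemma pure_cycling_bij_betw: "bij_betw pure_cycling (words \<Gamma> n) (words \<Gamma> n)"
proof (rule bij_betwI')
  fix x y :: "'a list"
  show "(pure_cycling x = pure_cycling y) = (x = y)"
    using inj_rotate1 by (auto simp: pure_cycling_def inj_def)
next
  fix x assume "x \<in> words \<Gamma> n"
  then show "pure_cycling x \<in> words \<Gamma> n"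
    by (simp add: pure_cycling_def words_def)
next
  fix y :: "'a list" assume y: "y \<in> words \<Gamma> n"
  obtain x where x: "y = rotate1 x"
    using surj_rotate1 by (rule surjE)
  with y have "x \<in> words \<Gamma> n"
    by (simp add: words_def)
  with x show "\<exists>x\<in>words \<Gamma> n. y = pure_cycling x"
    by (auto simp: pure_cycling_def)
qed

lemma Suc_mod_bij_betw:
  fixes k :: nat
  assumes "k > 0"
  shows "bij_betw (\<lambda>i. (i + 1) mod k) {0..<k} {0..<k}"
proof -
  have "inj_on (\<lambda>i. (i + 1) mod k) {0..<k}"
    using assms by (auto simp: inj_on_def mod_Suc split: if_splits)
  moreover have "(\<lambda>i. (i + 1) mod k) ` {0..<k} \<subseteq> {0..<k}"
    using assms by auto
  ultimately show ?thesis
    by (simp add: bij_betw_def endo_inj_surj)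
qed

lemma factor_map_bij_betw:
  assumes "k > 0" and "bij_betw r (words \<Gamma> n) (words \<Gamma> n)"
  shows "bij_betw (factor_map k r) (factor_carrier \<Gamma> n k) (factor_carrier \<Gamma> n k)"
proof -
  have "factor_map k r = map_prod r (\<lambda>i. (i + 1) mod k)"
    by (simp add: factor_map_def map_prod_def)
  then show ?thesis
    unfolding factor_carrier_def
    using bij_betw_map_prod[OF assms(2) Suc_mod_bij_betw[OF assms(1)]] by simp
qed

end

theory Submission
  imports Defs
begin

text \<open>
  The number of cycles is an average number of fixed points, as in Burnside's lemma. If the
  \<open>N\<close>-th iterate of a self-map \<open>f\<close> of a finite set is the identity, then each \<open>x\<close> on a cycle of
  length \<open>p\<close> is fixed by exactly \<open>N / p\<close> of the iterates with exponents \<open>1, \<dots>, N\<close>, so every cycle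
  contributes \<open>p * (N / p) = N\<close> to the total number of fixed points
  (\<open>card_orbits_times_exponent\<close>).

  For the factor map the exponent \<open>N = lcm n k\<close> is available. Its \<open>t\<close>-th iterate moves every residue
  unless \<open>k\<close> divides \<open>t\<close>. If \<open>k\<close> divides \<open>t\<close>, all residues are fixed, and a word is fixed iff
  rotation by \<open>gcd n t\<close> fixes it, that is, iff it is a power of a word of length \<open>gcd n t\<close>
  (\<open>card_words_fixed_by_rotate\<close>). Write \<open>g = gcd n k\<close>, \<open>n = g * m\<close> and \<open>q\<close> for the alphabet size.
  The exponents that count are \<open>t = k * j\<close> with \<open>1 \<le> j \<le> m\<close>, and there \<open>gcd n t = g * gcd j m\<close>
  because \<open>k / g\<close> is coprime to \<open>m\<close>. After cancelling \<open>k\<close>, the number of cycles times \<open>m\<close> is the sum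
  of \<open>q ^ (g * gcd j m)\<close> over \<open>j\<close>. Exactly \<open>totient (m / e)\<close> of the \<open>j\<close> have \<open>gcd j m = e\<close>, and the
  substitution \<open>d = g * e\<close> gives the formula.
\<close>

section \<open>Counting the cycles of a periodic map\<close>

lemma card_multiples:
  fixes p N :: nat
  assumes "p > 0" and "p dvd N"
  shows "card {t \<in> {0<..N}. p dvd t} = N div p"
proof -
  have "{t \<in> {0<..N}. p dvd t} = (\<lambda>j. p * j) ` {0<..N div p}"
    using assms by (auto elim!: dvdE)
  then show ?thesis
    using assms by (simp add: card_image inj_on_def)
qed

lemma funpow_fixed_iff_period_dvd:
  assumes "x \<in> orbit f x"
  shows "(f ^^ t) x = x \<longleftrightarrow> funpow_dist1 f x x dvd t"
proof -
  let ?p = "funpow_dist1 f x x"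
  have p: "(f ^^ ?p) x = x"
    using assms by (rule funpow_dist1_prop)
  have "(f ^^ t) x = (f ^^ (t mod ?p)) x"
    using p by (rule funpow_mod_eq[symmetric])
  moreover have "(f ^^ (t mod ?p)) x = x \<longleftrightarrow> t mod ?p = 0"
    using funpow_dist1_least[of "t mod ?p" f x x] by auto
  ultimately show ?thesis
    by (simp add: dvd_eq_mod_eq_0)
qed

text \<open>
  This is the orbit-stabilizer theorem for the cyclic group of order \<open>N\<close> that acts through the
  iterates of \<open>f\<close>.
\<close>
lemma card_return_times_mult_card_orbit:
  assumes "N > 0" and "(f ^^ N) x = x"
  shows "card {t \<in> {0<..N}. (f ^^ t) x = x} * card (orbit f x) = N"
proof -
  let ?p = "funpow_dist1 f x x"
  have x: "x \<in> orbit f x"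
    using assms by (metis (mono_tags, lifting) orbit_altdef mem_Collect_eq)
  have "card (orbit f x) = ?p"
    by (subst orbit_conv_funpow_dist1[OF x])
      (simp add: card_image[OF inj_on_funpow_dist1[OF x]])
  moreover have "?p dvd N"
    using assms(2) funpow_fixed_iff_period_dvd[OF x] by blast
  then have "card {t \<in> {0<..N}. (f ^^ t) x = x} = N div ?p"
    using card_multiples[of ?p N] by (simp add: funpow_fixed_iff_period_dvd[OF x])
  ultimately show ?thesis
    using \<open>?p dvd N\<close> by (metis dvd_div_mult_self)
qed

lemma card_orbits_times_exponent:
  assumes "finite X" and "f ` X \<subseteq> X" and "N > 0" and "\<And>x. x \<in> X \<Longrightarrow> (f ^^ N) x = x"
  shows "card (orbit f ` X) * N = (\<Sum>t\<in>{0<..N}. card {x \<in> X. (f ^^ t) x = x})"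
proof -
  let ?c = "\<lambda>x. card {t \<in> {0<..N}. (f ^^ t) x = x}"
  have self: "x \<in> orbit f x" if "x \<in> X" for x
    using assms(3) assms(4)[OF that] by (metis (mono_tags, lifting) orbit_altdef mem_Collect_eq)
  have subset: "y \<in> X" if "y \<in> orbit f x" "x \<in> X" for x y
    using that(1) by induct (use that(2) assms(2) in auto)
  have fibre: "{y \<in> X. orbit f y = orbit f x} = orbit f x" if x: "x \<in> X" for x
  proof (intro equalityI subsetI)
    fix y assume y: "y \<in> orbit f x"
    then have "x \<in> orbit f y"
      using self[OF x] by (rule orbit_swap[rotated])
    then show "y \<in> {y \<in> X. orbit f y = orbit f x}"
      using y subset[OF y x] by (auto intro: orbit_trans)
  qed (use self in auto)
  have cycle: "sum ?c {y \<in> X. orbit f y = O'} = N" if "O' \<in> orbit f ` X" for O'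
  proof -
    from that obtain x where x: "x \<in> X" and O': "O' = orbit f x"
      by blast
    have fib: "{y \<in> X. orbit f y = O'} = O'"
      using fibre[OF x] O' by simp
    have "?c y * card O' = N" if "y \<in> O'" for y
    proof -
      have y: "y \<in> X" "orbit f y = O'"
        using that fib by blast+
      show ?thesis
        using card_return_times_mult_card_orbit[OF assms(3) assms(4)[OF y(1)]] y(2) by simp
    qed
    then have "card O' * sum ?c O' = (\<Sum>y\<in>O'. N)"
      by (simp add: sum_distrib_left mult.commute)
    then have "card O' * sum ?c O' = card O' * N"
      by simp
    moreover have "card O' \<noteq> 0"
      using finite_orbit[OF self[OF x]] orbit_nonempty[of f x] O' by simp
    ultimately show ?thesis
      using fib by simp
  qed
  have "card (orbit f ` X) * N = (\<Sum>O'\<in>orbit f ` X. N)"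
    by simp
  also have "\<dots> = (\<Sum>O'\<in>orbit f ` X. sum ?c {y \<in> X. orbit f y = O'})"
    by (rule sum.cong[OF refl cycle[symmetric]])
  also have "\<dots> = sum ?c X"
    using assms(1) by (rule sum.image_gen[symmetric])
  also have "\<dots> = (\<Sum>x\<in>X. \<Sum>t\<in>{0<..N}. if (f ^^ t) x = x then 1 else 0)"
    by (simp add: sum.If_cases Int_def)
  also have "\<dots> = (\<Sum>t\<in>{0<..N}. \<Sum>x\<in>X. if (f ^^ t) x = x then 1 else 0)"
    by (rule sum.swap)
  also have "\<dots> = (\<Sum>t\<in>{0<..N}. card {x \<in> X. (f ^^ t) x = x})"
    using assms(1) by (simp add: sum.If_cases Int_def)
  finally show ?thesis .
qed

section \<open>Words fixed by a rotation\<close>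

lemma rotate_mult_fixed:
  assumes "rotate t s = s"
  shows "rotate (a * t) s = s"
  by (induction a) (simp_all add: assms rotate_rotate[symmetric])

text \<open>
  The exponents of the rotations that fix a word form a group containing the length of the word;
  Bezout's identity puts the gcd into it.
\<close>
lemma rotate_fixed_iff_gcd:
  assumes "length s = n"
  shows "rotate t s = s \<longleftrightarrow> rotate (gcd n t) s = s"
proof
  assume fixed: "rotate t s = s"
  show "rotate (gcd n t) s = s"
  proof (cases "t = 0")
    case True
    then show ?thesis
      using assms by simp
  next
    case False
    then obtain a b where ab: "t * a = n * b + gcd t n"
      using bezout_nat by blast
    have "s = rotate (t * a) s"
      using rotate_mult_fixed[OF fixed, of a] by (simp add: mult.commute)
    also have "\<dots> = rotate (gcd t n) s"
      using assms ab by (metis mod_mult_self4 rotate_conv_mod)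
    finally show ?thesis
      by (simp add: gcd.commute)
  qed
next
  assume "rotate (gcd n t) s = s"
  then show "rotate t s = s"
    using rotate_mult_fixed[of "gcd n t" s "t div gcd n t"] by simp
qed

lemma length_concat_replicate: "length (concat (replicate m w)) = m * length w"
  by (induction m) simp_all

lemma concat_replicate_commute:
  "concat (replicate m w) @ w = w @ concat (replicate m w)"
  by (induction m) simp_all

lemma commuting_word_is_power:
  assumes "u @ w = w @ u" and "length u = m * length w"
  shows "u = concat (replicate m w)"
  using assms
proof (induction m arbitrary: u)
  case (Suc m)
  then have "length w \<le> length u"
    by simp
  then obtain v where v: "u = w @ v"
    using Suc.prems(1) by (metis append_eq_append_conv_if append_take_drop_id)
  then have "v @ w = w @ v"
    using Suc.prems(1) by simp
  moreover have "length v = m * length w"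
    using v Suc.prems(2) by simp
  ultimately show ?case
    using Suc.IH v by simp
qed simp

text \<open>
  Splitting off the first \<open>d\<close> letters writes a fixed word as \<open>w @ u\<close> with \<open>w @ u = u @ w\<close>, so that
  \<open>u\<close> is a power of \<open>w\<close>.
\<close>
lemma words_fixed_by_rotate_dvd:
  assumes "d > 0" and "m > 0"
  shows "{s \<in> words \<Gamma> (d * m). rotate d s = s} = (\<lambda>w. concat (replicate m w)) ` words \<Gamma> d"
proof (intro equalityI subsetI)
  fix s assume s: "s \<in> {s \<in> words \<Gamma> (d * m). rotate d s = s}"
  obtain l where m: "m = Suc l"
    using assms(2) by (cases m) auto
  define w u where "w = take d s" and "u = drop d s"
  have len: "length s = d * m" and sub: "set s \<subseteq> \<Gamma>"
    using s by (auto simp: words_def)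
  have split: "s = w @ u"
    by (simp add: w_def u_def)
  have lens: "length w = d" "length u = l * length w"
    using len by (simp_all add: w_def u_def m)
  have "rotate d s = u @ w"
    unfolding split using lens(1) rotate_append[of w u] by simp
  then have "u @ w = w @ u"
    using s split by simp
  then have "u = concat (replicate l w)"
    using lens(2) by (rule commuting_word_is_power)
  then have "s = concat (replicate m w)"
    by (simp add: split m)
  moreover have "w \<in> words \<Gamma> d"
    using lens(1) sub split by (auto simp: words_def)
  ultimately show "s \<in> (\<lambda>w. concat (replicate m w)) ` words \<Gamma> d"
    by blast
next
  fix s assume "s \<in> (\<lambda>w. concat (replicate m w)) ` words \<Gamma> d"
  then obtain w where w: "set w \<subseteq> \<Gamma>" "length w = d" and s: "s = concat (replicate m w)"
    by (auto simp: words_def)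
  obtain l where m: "m = Suc l"
    using assms(2) by (cases m) auto
  have "rotate d s = s"
    using rotate_append[of w "concat (replicate l w)"] w(2)
    by (simp add: s m concat_replicate_commute)
  moreover have "s \<in> words \<Gamma> (d * m)"
    using w by (auto simp: words_def s length_concat_replicate)
  ultimately show "s \<in> {s \<in> words \<Gamma> (d * m). rotate d s = s}"
    by blast
qed

lemma card_words_fixed_by_rotate:
  assumes "finite \<Gamma>" and "n > 0"
  shows "card {s \<in> words \<Gamma> n. rotate t s = s} = card \<Gamma> ^ gcd n t"
proof -
  define d m where "d = gcd n t" and "m = n div gcd n t"
  have n: "n = d * m"
    by (simp add: d_def m_def)
  then have pos: "d > 0" "m > 0"
    using assms(2) by auto
  have "{s \<in> words \<Gamma> n. rotate t s = s} = {s \<in> words \<Gamma> n. rotate d s = s}"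
    using rotate_fixed_iff_gcd by (auto simp: words_def d_def)
  also have "\<dots> = (\<lambda>w. concat (replicate m w)) ` words \<Gamma> d"
    unfolding n by (rule words_fixed_by_rotate_dvd[OF pos])
  also have "card \<dots> = card (words \<Gamma> d)"
  proof (rule card_image, rule inj_onI)
    fix v w assume vw: "v \<in> words \<Gamma> d" "w \<in> words \<Gamma> d"
      and eq: "concat (replicate m v) = concat (replicate m w)"
    from eq have "take d (concat (replicate m v)) = take d (concat (replicate m w))"
      by simp
    then show "v = w"
      using vw pos by (cases m) (simp_all add: words_def)
  qed
  also have "\<dots> = card \<Gamma> ^ d"
    using assms(1) by (simp add: words_def card_lists_length_eq)
  finally show ?thesis
    by (simp add: d_def)
qed

section \<open>Fixed points of the iterates of the factor map\<close>

lemma funpow_factor_map: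
  assumes "i < k"
  shows "(factor_map k pure_cycling ^^ t) (s, i) = (rotate t s, (i + t) mod k)"
  using assms
  by (induction t) (simp_all add: factor_map_def pure_cycling_def mod_Suc_eq)

lemma shift_mod_fixed_iff_dvd:
  fixes i k t :: nat
  assumes "i < k"
  shows "(i + t) mod k = i \<longleftrightarrow> k dvd t"
proof -
  have "(i + t) mod k = i \<longleftrightarrow> (i + t) mod k = (i + 0) mod k"
    using assms by simp
  also have "\<dots> \<longleftrightarrow> k dvd t"
    by (metis add_0_right cong_add_lcancel_nat cong_def cong_0_iff)
  finally show ?thesis .
qed

lemma card_fixed_funpow_factor_map:
  assumes "finite \<Gamma>" and "n > 0"
  shows "card {x \<in> factor_carrier \<Gamma> n k. (factor_map k pure_cycling ^^ t) x = x} =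
    (if k dvd t then k * card \<Gamma> ^ gcd n t else 0)"
proof -
  have "{x \<in> factor_carrier \<Gamma> n k. (factor_map k pure_cycling ^^ t) x = x} =
      (if k dvd t then {s \<in> words \<Gamma> n. rotate t s = s} \<times> {0..<k} else {})"
    by (auto simp: factor_carrier_def funpow_factor_map shift_mod_fixed_iff_dvd)
  then show ?thesis
    using card_words_fixed_by_rotate[OF assms]
    by (simp add: card_cartesian_product)
qed

section \<open>The cycle count\<close>

lemma sum_gcd_eq_sum_totient:
  fixes h :: "nat \<Rightarrow> nat"
  assumes "m > 0"
  shows "(\<Sum>j\<in>{0<..m}. h (gcd j m)) = (\<Sum>e | e dvd m. totient (m div e) * h e)"
proof -
  have "(\<Sum>j\<in>{0<..m}. h (gcd j m)) =
      (\<Sum>e | e dvd m. \<Sum>j | j \<in> {0<..m} \<and> gcd j m = e. h (gcd j m))"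
    using assms by (intro sum.group[symmetric]) auto
  also have "\<dots> = (\<Sum>e | e dvd m. card {j \<in> {0<..m}. gcd j m = e} * h e)"
    by (intro sum.cong refl) simp
  also have "\<dots> = (\<Sum>e | e dvd m. totient (m div e) * h e)"
    using assms by (intro sum.cong refl) (use card_gcd_eq_totient[of m] in auto)
  finally show ?thesis .
qed

theorem corollary1:
  fixes \<Gamma> :: "'a set" and n k :: nat
  assumes "finite \<Gamma>" and "\<Gamma> \<noteq> {}" and "n > 0" and "k > 0"
  shows "real (card (factor_cycles \<Gamma> n k pure_cycling)) =
    real (gcd n k) / real n *
      (\<Sum>d | d > 0 \<and> gcd n k dvd d \<and> d dvd n. real (totient (n div d)) * real (card \<Gamma>) ^ d)"
proof -
  define f where "f = factor_map k (pure_cycling :: 'a list \<Rightarrow> 'a list)"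
  define X where "X = factor_carrier \<Gamma> n k"
  define g where "g = gcd n k"
  define m where "m = n div g"
  define q where "q = card \<Gamma>"
  define C where "C = card (factor_cycles \<Gamma> n k pure_cycling)"
  have n: "n = g * m" and g: "g > 0"
    using assms(3) by (simp_all add: g_def m_def)
  then have m: "m > 0"
    using assms(3) by auto
  have lcm: "lcm n k = k * m"
    unfolding m_def g_def by (simp add: lcm_nat_def div_mult_swap mult.commute)
  have "finite X"
    using finite_lists_length_eq[OF assms(1), of n]
    by (simp add: X_def factor_carrier_def words_def)
  moreover have "f ` X \<subseteq> X"
    using factor_map_bij_betw[OF assms(4) pure_cycling_bij_betw, of \<Gamma> n]
    by (simp add: f_def X_def bij_betw_def)
  moreover have "lcm n k > 0"
    using assms(3,4) by (simp add: lcm_pos_nat)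
  moreover have "(f ^^ lcm n k) x = x" if "x \<in> X" for x
  proof -
    from that obtain s i where x: "x = (s, i)" "length s = n" "i < k"
      by (auto simp: X_def factor_carrier_def words_def)
    have "rotate (lcm n k) s = s"
      using x(2) by (intro rotate_id) simp
    then show ?thesis
      using x by (simp add: f_def funpow_factor_map shift_mod_fixed_iff_dvd)
  qed
  ultimately have "C * (k * m) = (\<Sum>t\<in>{0<..lcm n k}. card {x \<in> X. (f ^^ t) x = x})"
    using card_orbits_times_exponent[of X f "lcm n k"]
    by (simp add: C_def factor_cycles_def f_def X_def lcm)
  also have "\<dots> = (\<Sum>t\<in>{0<..k * m}. if k dvd t then k * q ^ gcd n t else 0)"
    unfolding q_def using card_fixed_funpow_factor_map[OF assms(1,3)]
    by (simp add: f_def X_def lcm)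
  also have "\<dots> = (\<Sum>t | t \<in> {0<..k * m} \<and> k dvd t. k * q ^ gcd n t)"
    by (simp add: sum.If_cases Int_def)
  also have "\<dots> = (\<Sum>j\<in>{0<..m}. k * q ^ gcd n (k * j))"
    by (rule sum.reindex_bij_witness[of _ "\<lambda>j. k * j" "\<lambda>t. t div k"])
      (use assms(4) in \<open>auto elim!: dvdE\<close>)
  also have "\<dots> = k * (\<Sum>j\<in>{0<..m}. q ^ gcd n (k * j))"
    by (simp add: sum_distrib_left)
  finally have "C * m = (\<Sum>j\<in>{0<..m}. q ^ gcd n (k * j))"
    using assms(4) by simp
  also have "\<dots> = (\<Sum>j\<in>{0<..m}. q ^ (g * gcd j m))"
  proof (intro sum.cong refl)
    fix j
    define l where "l = k div g"
    have k: "k = g * l"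
      by (simp add: l_def g_def)
    have "coprime m l"
      unfolding m_def l_def g_def using assms(3) by (intro div_gcd_coprime) simp
    have "gcd n (k * j) = g * gcd m (l * j)"
      unfolding n k by (simp add: mult.assoc gcd_mult_distrib_nat)
    also have "gcd m (l * j) = gcd j m"
      using \<open>coprime m l\<close> by (metis gcd.commute gcd_mult_left_left_cancel coprime_commute)
    finally show "q ^ gcd n (k * j) = q ^ (g * gcd j m)"
      by simp
  qed
  also have "\<dots> = (\<Sum>e | e dvd m. totient (m div e) * q ^ (g * e))"
    by (rule sum_gcd_eq_sum_totient[OF m])
  also have "\<dots> = (\<Sum>d | d > 0 \<and> g dvd d \<and> d dvd n. totient (n div d) * q ^ d)"
    by (rule sum.reindex_bij_witness[of _ "\<lambda>d. d div g" "\<lambda>e. g * e"])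
      (use g m n in \<open>auto elim!: dvdE\<close>)
  finally have "real C * real m = (\<Sum>d | d > 0 \<and> g dvd d \<and> d dvd n. real (totient (n div d)) * real q ^ d)"
    by (metis (mono_tags, lifting) of_nat_mult of_nat_sum of_nat_power sum.cong)
  moreover have "real C = real g / real n * (real C * real m)"
    using g m by (simp add: n)
  ultimately show ?thesis
    by (simp add: C_def g_def q_def)
qed

end
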